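(* There is a universal constant $K>0$ such that the following holds. Let $(\mathbf X,k),(\mathbf X_1,k_1),\dots,(\mathbf X_n,k_n)$ be labelled $d\times d$ images generated by the scaling/shift/brightness model of the context with template functions $f_0,f_1$. Suppose that both labels occur in the training data, that is, $\{i\in\{1,\dots,n\}:k_i=0\}\neq\varnothing$ and $\{i\in\{1,\dots,n\}:k_i=1\}\neq\varnothing$. Assume that $f_0,f_1$ satisfy, with constant $C_L>0$, $$|f_k(u,v)-f_k(u',v')|\le C_L\|f_k\|_1(|u-u'|+|v-v'|)\quad\text{for all }u,v,u',v'\in\mathbb R,\ k=0,1,$$ that the supports of $f_0,f_1$ are contained in $[1/4,3/4]^2$, and that the deformation parameters $(\tau,\tau',\xi,\xi')$ of each of the $n+1$ images satisfy $\xi,\xi'\ge1/2$, $-\frac14\le\tau\le\xi-\frac34$ and $-\frac14\le\tau'\le\xi'-\frac34$. Set $\Xi_n:=\max\{1,\xi,\xi',\xi_1,\xi_1',\dots,\xi_n,\xi_n'\}$. If $$D>\frac{4K(C_L\vee C_L^2)\,\Xi_n^2}{d},$$ then the image alignment classifier $\widehat k$ satisfies $\widehat k=k$.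
   Context: Notation: $\|\cdot\|_p$ is the $L^p$-norm on $[0,1]^2$; $x\vee y=\max\{x,y\}$; the support of $g$ is $\{x:g(x)\ne0\}$; $I_{j,\ell}=[\frac{j-1}d,\frac jd)\times[\frac{\ell-1}d,\frac\ell d)$. Model: $f_0,f_1:\mathbb R^2\to[0,\infty)$ are template functions, not identically zero. The $i$-th image $\mathbf X_i=(X^{(i)}_{j,\ell})_{j,\ell=1,\dots,d}$ with label $k_i\in\{0,1\}$ has entries $X^{(i)}_{j,\ell}=d^2\eta_i\int_{I_{j,\ell}}f_{k_i}(\xi_iu-\tau_i,\xi_i'v-\tau_i')\,du\,dv$ with brightness $\eta_i>0$ and parameters $\xi_i,\xi_i',\tau_i,\tau_i'$; the image $\mathbf X$ with label $k$ is generated in the same way with parameters $\eta>0,\xi,\xi',\tau,\tau'$. Image alignment classifier: for an image $\mathbf X$ let $j_-$ (resp. $j_+$) be the smallest (resp. largest) $j$ such that $X_{j,\ell}>0$ for some $\ell$, and $\ell_-$ (resp. $\ell_+$) the smallest (resp. largest) $\ell$ such that $X_{j,\ell}>0$ for some $j$. For $t,t'\in[0,1]$ put $Z_{\mathbf X}(t,t')=X_{\lfloor j_-+t(j_+-j_-)\rfloor,\lfloor\ell_-+t'(\ell_+-\ell_-)\rfloor}$ and $T_{\mathbf X}=Z_{\mathbf X}/\|Z_{\mathbf X}\|_2$. Then $\widehat k:=k_{\widehat i}$ with $\widehat i\in\arg\min_{i\in\{1,\dots,n\}}\|T_{\mathbf X}-T_{\mathbf X_i}\|_2$ (any minimizer).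 Separation quantity: $D=D(f_0,f_1)\vee D(f_1,f_0)$ with $$D(f,g):=\frac{\inf_{a,b,c,b',c'\in\mathbb R}\|a f(b\,\cdot-c,b'\,\cdot-c')-g\|_{L^2(\mathbb R^2)}}{\|g\|_{L^2(\mathbb R^2)}}.$$ *)

theory Defs
  imports "HOL-Analysis.Analysis"
begin

section \<open>Norms\<close>

definition unit_square :: "(real \<times> real) set" where
  "unit_square = {0..1} \<times> {0..1}"

definition L1_norm_unit :: "(real \<times> real \<Rightarrow> real) \<Rightarrow> real" where
  "L1_norm_unit g = (LINT p:unit_square|lborel. \<bar>g p\<bar>)"

definition L2_norm_unit :: "(real \<times> real \<Rightarrow> real) \<Rightarrow> real" where
  "L2_norm_unit g = sqrt (LINT p:unit_square|lborel. (g p)\<^sup>2)"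

text \<open>The norm on the whole plane takes the value \<open>\<infinity>\<close> on functions that are not square
  integrable. Such functions do occur in the infimum below (namely when one of the scalings is
  \<open>0\<close>); with the real-valued integral they would be assigned norm \<open>0\<close>.\<close>

definition L2_norm_plane :: "(real \<times> real \<Rightarrow> real) \<Rightarrow> ennreal" where
  "L2_norm_plane g =
    (let I = (\<integral>\<^sup>+ p. ennreal ((g p)\<^sup>2) \<partial>lborel)
     in if I = \<infinity> then \<infinity> else ennreal (sqrt (enn2real I)))"


section \<open>Images\<close>

text \<open>A \<open>d \<times> d\<close> image is a function \<open>X\<close> of which only the entries \<open>X j l\<close> with
  \<open>j, l \<in> {1..d}\<close> are meaningful.\<close>

type_synonym image = "nat \<Rightarrow> nat \<Rightarrow> real"

definition pixel_cell :: "nat \<Rightarrow> nat \<Rightarrow> nat \<Rightarrow> (real \<times> real) set" where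
  "pixel_cell d j l =
    {(real j - 1) / real d ..< real j / real d} \<times> {(real l - 1) / real d ..< real l / real d}"

text \<open>Arguments after the template: brightness \<open>\<eta>\<close>, scalings \<open>\<xi>, \<xi>'\<close>, shifts \<open>\<tau>, \<tau>'\<close>.\<close>

definition model_image ::
  "nat \<Rightarrow> (real \<times> real \<Rightarrow> real) \<Rightarrow> real \<Rightarrow> real \<Rightarrow> real \<Rightarrow> real \<Rightarrow> real \<Rightarrow> image" where
  "model_image d f \<eta> \<xi> \<xi>' \<tau> \<tau>' = (\<lambda>j l.
    (real d)\<^sup>2 * \<eta> * (LINT p:pixel_cell d j l|lborel. f (\<xi> * fst p - \<tau>, \<xi>' * snd p - \<tau>')))"


section \<open>Image alignment classifier\<close>

definition active_rows :: "nat \<Rightarrow> image \<Rightarrow> nat set" where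
  "active_rows d X = {j \<in> {1..d}. \<exists>l\<in>{1..d}. X j l > 0}"

definition active_cols :: "nat \<Rightarrow> image \<Rightarrow> nat set" where
  "active_cols d X = {l \<in> {1..d}. \<exists>j\<in>{1..d}. X j l > 0}"

text \<open>The index selected by parameter \<open>t \<in> [0,1]\<close> between the extreme indices in \<open>S\<close>.\<close>

definition rescaled_index :: "nat set \<Rightarrow> real \<Rightarrow> nat" where
  "rescaled_index S t = nat \<lfloor>real (Min S) + t * (real (Max S) - real (Min S))\<rfloor>"

definition aligned :: "nat \<Rightarrow> image \<Rightarrow> real \<times> real \<Rightarrow> real" where
  "aligned d X = (\<lambda>(t, t').
    X (rescaled_index (active_rows d X) t) (rescaled_index (active_cols d X) t'))"

definition alignment_transform :: "nat \<Rightarrow> image \<Rightarrow> real \<times> real \<Rightarrow> real" where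
  "alignment_transform d X = (\<lambda>p. aligned d X p / L2_norm_unit (aligned d X))"

text \<open>\<open>i\<close> is one of the minimizers among the \<open>n\<close> training images \<open>Xs 1, \<dots>, Xs n\<close>; the
  classifier may pick any of these.\<close>

definition is_alignment_index :: "nat \<Rightarrow> nat \<Rightarrow> (nat \<Rightarrow> image) \<Rightarrow> image \<Rightarrow> nat \<Rightarrow> bool" where
  "is_alignment_index d n Xs X i \<longleftrightarrow>
    is_arg_min
      (\<lambda>i. L2_norm_unit (\<lambda>p. alignment_transform d X p - alignment_transform d (Xs i) p))
      (\<lambda>i. i \<in> {1..n}) i"


section \<open>Separation quantity\<close>

definition separation :: "(real \<times> real \<Rightarrow> real) \<Rightarrow> (real \<times> real \<Rightarrow> real) \<Rightarrow> ennreal" where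
  "separation f g =
    (INF (a, b, c, b', c') \<in> UNIV.
       L2_norm_plane (\<lambda>(u, v). a * f (b * u - c, b' * v - c') - g (u, v))) / L2_norm_plane g"

definition max_separation :: "(real \<times> real \<Rightarrow> real) \<Rightarrow> (real \<times> real \<Rightarrow> real) \<Rightarrow> ennreal" where
  "max_separation f g = max (separation f g) (separation g f)"


section \<open>Assumptions\<close>

definition template :: "(real \<times> real \<Rightarrow> real) \<Rightarrow> bool" where
  "template f \<longleftrightarrow> (\<forall>p. 0 \<le> f p) \<and> (\<exists>p. f p \<noteq> 0)"

definition lipschitz_template :: "real \<Rightarrow> (real \<times> real \<Rightarrow> real) \<Rightarrow> bool" where
  "lipschitz_template C f \<longleftrightarrow>
    (\<forall>u v u' v'. \<bar>f (u, v) - f (u', v')\<bar> \<le> C * L1_norm_unit f * (\<bar>u - u'\<bar> + \<bar>v - v'\<bar>))"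

definition centrally_supported :: "(real \<times> real \<Rightarrow> real) \<Rightarrow> bool" where
  "centrally_supported f \<longleftrightarrow> {p. f p \<noteq> 0} \<subseteq> {1/4..3/4} \<times> {1/4..3/4}"

definition admissible_deformation :: "real \<Rightarrow> real \<Rightarrow> real \<Rightarrow> real \<Rightarrow> bool" where
  "admissible_deformation \<xi> \<xi>' \<tau> \<tau>' \<longleftrightarrow>
    1/2 \<le> \<xi> \<and> 1/2 \<le> \<xi>' \<and> - 1/4 \<le> \<tau> \<and> \<tau> \<le> \<xi> - 3/4 \<and> - 1/4 \<le> \<tau>' \<and> \<tau>' \<le> \<xi>' - 3/4"

end

(*
  Rescaling a template f to the rectangle spanned by its support gives a function h_f on the unit
  square that no longer depends on the deformation. Each aligned image is the discretisation of
  (a multiple of) h_f: the extreme active pixels locate the support up to one pixel, so by the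
  Lipschitz condition the aligned image differs from eta * h_f by at most
  4 C eta ||f||_1 Xi / d. Since ||f||_1 <= ||h_f||_2, normalising shows that T_X is within
  8 C Xi / d of h_f / ||h_f||. A linear substitution turns the distance between the normalised
  h_f and h_g into a competitor in the infimum defining the separation, in both orders. So if the
  nearest training image had the wrong label, the separation would be at most four times
  8 C Xi / d.
*)

theory Submission
  imports Defs
begin

section \<open>The norm of the unit square\<close>

lemma unit_square_eq_cbox: "unit_square = cbox (0, 0) (1, 1)"
  unfolding unit_square_def by (simp add: cbox_Pair_eq)

lemma unit_square_borel [measurable]: "unit_square \<in> sets borel"
  by (simp add: unit_square_eq_cbox)

lemma emeasure_unit_square: "emeasure lborel unit_square = 1"
  unfolding unit_square_eq_cbox
  by (subst emeasure_lborel_cbox_eq) (auto simp: Basis_prod_def)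

text \<open>The Bochner integral is 0 for a non-integrable integrand, so the norm inequalities for
  \<open>L2_norm_unit\<close> rely on this predicate. Measurability of \<open>g\<close> is a clause
  of its own because that of its square does not imply it.\<close>

definition square_integrable :: "(real \<times> real \<Rightarrow> real) \<Rightarrow> bool" where
  "square_integrable g \<longleftrightarrow>
    g \<in> borel_measurable borel \<and> set_integrable lborel unit_square (\<lambda>p. (g p)\<^sup>2)"

lemma set_integrable_const_unit_square: "set_integrable lborel unit_square (\<lambda>p. c :: real)"
  unfolding set_integrable_def
  using emeasure_unit_square by (simp add: integrable_mult_left)

lemma square_integrable_bounded:
  assumes "g \<in> borel_measurable borel" "\<And>p. p \<in> unit_square \<Longrightarrow> \<bar>g p\<bar> \<le> B"
  shows "square_integrable g"
  unfolding square_integrable_def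
proof
  have "(g p)\<^sup>2 \<le> B\<^sup>2" if "p \<in> unit_square" for p
    using assms(2)[OF that] by (metis abs_ge_zero power2_abs power_mono)
  then show "set_integrable lborel unit_square (\<lambda>p. (g p)\<^sup>2)"
    using assms(1)
    by (intro set_integrable_bound[OF set_integrable_const_unit_square[of "B\<^sup>2"]])
       (auto simp: set_borel_measurable_def)
qed (fact assms(1))

text \<open>Domination: a product is bounded in absolute value by the sum of the two
  squares.\<close>

lemma square_integrable_mult:
  assumes "square_integrable g" "square_integrable h"
  shows "set_integrable lborel unit_square (\<lambda>p. g p * h p)"
proof (rule set_integrable_bound)
  show "set_integrable lborel unit_square (\<lambda>p. (g p)\<^sup>2 + (h p)\<^sup>2)"
    using assms by (auto simp: square_integrable_def intro: set_integral_add)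
  show "set_borel_measurable lborel unit_square (\<lambda>p. g p * h p)"
    using assms unfolding set_borel_measurable_def square_integrable_def by auto
  have "\<bar>x * y\<bar> \<le> \<bar>x\<^sup>2 + y\<^sup>2\<bar>" for x y :: real
  proof -
    have "2 * (\<bar>x\<bar> * \<bar>y\<bar>) \<le> x\<^sup>2 + y\<^sup>2"
      using sum_squares_bound[of "\<bar>x\<bar>" "\<bar>y\<bar>"] by simp
    then show ?thesis
      using mult_nonneg_nonneg[OF abs_ge_zero[of x] abs_ge_zero[of y]] abs_ge_self[of "x\<^sup>2 + y\<^sup>2"]
      unfolding abs_mult by linarith
  qed
  then show "AE p in lborel. p \<in> unit_square \<longrightarrow> norm (g p * h p) \<le> norm ((g p)\<^sup>2 + (h p)\<^sup>2)"
    by simp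
qed

lemma square_integrable_scale:
  "square_integrable g \<Longrightarrow> square_integrable (\<lambda>p. c * g p)"
  unfolding square_integrable_def
  by (auto simp: power_mult_distrib)

lemma square_integrable_add:
  assumes "square_integrable g" "square_integrable h"
  shows "square_integrable (\<lambda>p. g p + h p)"
proof -
  have "set_integrable lborel unit_square (\<lambda>p. ((g p)\<^sup>2 + (h p)\<^sup>2) + 2 * (g p * h p))"
    using assms square_integrable_mult[OF assms]
    by (auto simp: square_integrable_def intro!: set_integral_add)
  moreover have "(g p + h p)\<^sup>2 = ((g p)\<^sup>2 + (h p)\<^sup>2) + 2 * (g p * h p)" for p
    by (simp add: power2_sum)
  ultimately show ?thesis
    using assms by (auto simp: square_integrable_def)
qed

lemma square_integrable_diff:
  assumes "square_integrable g" "square_integrable h"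
  shows "square_integrable (\<lambda>p. g p - h p)"
  using square_integrable_add[OF assms(1) square_integrable_scale[OF assms(2), of "-1"]] by simp

section \<open>Norm inequalities on the unit square\<close>

lemma L2_norm_unit_nonneg: "0 \<le> L2_norm_unit g"
  unfolding L2_norm_unit_def set_lebesgue_integral_def by (auto intro!: integral_nonneg_AE)

lemma L2_norm_unit_square: "(L2_norm_unit g)\<^sup>2 = (LINT p:unit_square|lborel. (g p)\<^sup>2)"
  unfolding L2_norm_unit_def set_lebesgue_integral_def
  by (auto intro!: integral_nonneg_AE)

lemma L2_norm_unit_scale: "L2_norm_unit (\<lambda>p. c * g p) = \<bar>c\<bar> * L2_norm_unit g"
  unfolding L2_norm_unit_def by (simp add: power_mult_distrib real_sqrt_mult)

lemma L2_norm_unit_minus_commute: "L2_norm_unit (\<lambda>p. g p - h p) = L2_norm_unit (\<lambda>p. h p - g p)"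
  unfolding L2_norm_unit_def by (simp add: power2_commute)

text \<open>The unit square has measure 1, which turns uniform pixel errors into L2 errors with the
  same constant.\<close>

lemma L2_norm_unit_le_bound:
  assumes "g \<in> borel_measurable borel" "\<And>p. p \<in> unit_square \<Longrightarrow> \<bar>g p\<bar> \<le> B"
  shows "L2_norm_unit g \<le> B"
proof -
  have "0 \<le> B"
    using assms(2)[of "(0, 0)"] by (auto simp: unit_square_def)
  have "(g p)\<^sup>2 \<le> B\<^sup>2" if "p \<in> unit_square" for p
    using assms(2)[OF that] by (metis abs_ge_zero power2_abs power_mono)
  then have "(L2_norm_unit g)\<^sup>2 \<le> (LINT p:unit_square|lborel. B\<^sup>2)"
    using square_integrable_bounded[OF assms] set_integrable_const_unit_square
    unfolding L2_norm_unit_square square_integrable_def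
    by (intro set_integral_mono) auto
  also have "\<dots> = B\<^sup>2"
    by (simp add: set_lebesgue_integral_def measure_def emeasure_unit_square)
  finally show ?thesis
    using \<open>0 \<le> B\<close> by (rule power2_le_imp_le)
qed

text \<open>Cauchy-Schwarz, from nonnegativity of the integral of
  \<open>(a * g p - b * h p)\<^sup>2\<close> for suitable \<open>a\<close> and
  \<open>b\<close>.\<close>

lemma L2_norm_unit_inner_le:
  assumes "square_integrable g" "square_integrable h"
  shows "(LINT p:unit_square|lborel. g p * h p) \<le> L2_norm_unit g * L2_norm_unit h"
proof -
  let ?I = "\<lambda>w. LINT p:unit_square|lborel. w p :: real"
  let ?G = "L2_norm_unit g" and ?H = "L2_norm_unit h"
  note int = square_integrable_mult[OF assms]
  have expand: "0 \<le> a\<^sup>2 * ?G\<^sup>2 - 2 * a * b * ?I (\<lambda>p. g p * h p) + b\<^sup>2 * ?H\<^sup>2" for a b :: real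
  proof -
    have "0 \<le> ?I (\<lambda>p. (a * g p - b * h p)\<^sup>2)"
      unfolding set_lebesgue_integral_def by (auto intro!: integral_nonneg_AE)
    also have "\<dots> = ?I (\<lambda>p. (a\<^sup>2 * (g p)\<^sup>2 + b\<^sup>2 * (h p)\<^sup>2) - 2 * a * b * (g p * h p))"
      by (simp add: power2_diff power_mult_distrib algebra_simps)
    also have "\<dots> = (a\<^sup>2 * ?I (\<lambda>p. (g p)\<^sup>2) + b\<^sup>2 * ?I (\<lambda>p. (h p)\<^sup>2))
        - 2 * a * b * ?I (\<lambda>p. g p * h p)"
      using assms int unfolding square_integrable_def
      by (subst set_integral_diff(2) set_integral_add(2); (intro set_integral_add(1))?; simp)+
    finally show ?thesis by (simp add: L2_norm_unit_square)
  qed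
  show ?thesis
  proof (cases "?G * ?H = 0")
    case False
    then have pos: "0 < ?G * ?H"
      using L2_norm_unit_nonneg[of g] L2_norm_unit_nonneg[of h] by (simp add: zero_less_mult_iff less_le)
    \<comment> \<open>With \<open>a = ?H\<close> and \<open>b = ?G\<close> the quadratic form is
      twice \<open>?G * ?H\<close> times the difference of \<open>?G * ?H\<close> and the inner
      product.\<close>
    from expand[of ?H ?G]
    have "(?G * ?H) * ?I (\<lambda>p. g p * h p) \<le> (?G * ?H) * (?G * ?H)"
      by (simp add: power2_eq_square algebra_simps)
    with pos show ?thesis
      by (metis mult_le_cancel_left_pos)
  next
    case True
    let ?c = "?I (\<lambda>p. g p * h p)"
    have "?c \<le> 0"
    proof (rule ccontr)
      assume "\<not> ?c \<le> 0"
      then have c: "?c > 0" by simp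
      \<comment> \<open>If one norm vanishes, the form is affine in the coefficient of that
        function. The coefficient chosen below makes the cross term outweigh the square of the other
        norm, so the form becomes negative.\<close>
      consider "?G = 0" | "?H = 0" using True by auto
      then show False
      proof cases
        case 1
        with expand[of "(?H\<^sup>2 + 1) / ?c" 1] c show False
          by (simp add: add_nonneg_pos) (smt (verit) zero_le_power2)
      next
        case 2
        with expand[of 1 "(?G\<^sup>2 + 1) / ?c"] c show False
          by (simp add: add_nonneg_pos) (smt (verit) zero_le_power2)
      qed
    qed
    with True show ?thesis by linarith
  qed
qed

lemma L2_norm_unit_triangle:
  assumes "square_integrable g" "square_integrable h"
  shows "L2_norm_unit (\<lambda>p. g p + h p) \<le> L2_norm_unit g + L2_norm_unit h"
proof (rule power2_le_imp_le)
  have "(L2_norm_unit (\<lambda>p. g p + h p))\<^sup>2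
      = (LINT p:unit_square|lborel. ((g p)\<^sup>2 + (h p)\<^sup>2) + 2 * (g p * h p))"
    unfolding L2_norm_unit_square by (simp add: power2_sum mult.assoc)
  also have "\<dots> = ((L2_norm_unit g)\<^sup>2 + (L2_norm_unit h)\<^sup>2)
      + 2 * (LINT p:unit_square|lborel. g p * h p)"
    using assms square_integrable_mult[OF assms] unfolding square_integrable_def L2_norm_unit_square
    by (subst set_integral_add(2); (intro set_integral_add(1))?; simp)+
  also have "\<dots> \<le> (L2_norm_unit g + L2_norm_unit h)\<^sup>2"
    using L2_norm_unit_inner_le[OF assms] by (simp add: power2_sum)
  finally show "(L2_norm_unit (\<lambda>p. g p + h p))\<^sup>2 \<le> (L2_norm_unit g + L2_norm_unit h)\<^sup>2" .
  show "0 \<le> L2_norm_unit g + L2_norm_unit h"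
    by (simp add: L2_norm_unit_nonneg)
qed

lemma L2_norm_unit_triangle_diff:
  assumes "square_integrable u" "square_integrable v" "square_integrable w"
  shows "L2_norm_unit (\<lambda>p. u p - w p)
    \<le> L2_norm_unit (\<lambda>p. u p - v p) + L2_norm_unit (\<lambda>p. v p - w p)"
  using L2_norm_unit_triangle[OF square_integrable_diff[OF assms(1,2)]
      square_integrable_diff[OF assms(2,3)]] by simp

text \<open>The bound remains true for \<open>\<parallel>g\<parallel> = 0\<close>, where \<open>g / \<parallel>g\<parallel>\<close> is \<open>0\<close> by
  convention.\<close>

lemma L2_norm_unit_normalized_diff_le:
  assumes g: "square_integrable g" and h: "square_integrable h" and pos: "0 < L2_norm_unit h"
  shows "L2_norm_unit (\<lambda>p. g p / L2_norm_unit g - h p / L2_norm_unit h)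
    \<le> 2 * L2_norm_unit (\<lambda>p. g p - h p) / L2_norm_unit h"
proof -
  let ?G = "L2_norm_unit g" and ?H = "L2_norm_unit h" and ?E = "L2_norm_unit (\<lambda>p. g p - h p)"
  note gh = square_integrable_diff[OF g h]
  have "?G \<le> ?E + ?H"
    using L2_norm_unit_triangle[OF gh h] by simp
  moreover have "?H \<le> ?E + ?G"
    using L2_norm_unit_triangle[OF square_integrable_diff[OF h g] g]
    by (simp add: L2_norm_unit_minus_commute[of h g])
  ultimately have GH: "\<bar>?H - ?G\<bar> \<le> ?E" by linarith
  \<comment> \<open>The difference splits into \<open>(g p - h p) / ?H\<close> and a multiple of
    \<open>g p\<close>. Each part has norm at most \<open>?E / ?H\<close>, the second because the
    norms of \<open>g\<close> and \<open>h\<close> differ by at most \<open>?E\<close>.\<close>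
  have "L2_norm_unit (\<lambda>p. g p / ?G - h p / ?H)
      = L2_norm_unit (\<lambda>p. (1 / ?H) * (g p - h p) + (1 / ?G - 1 / ?H) * g p)"
    by (simp add: algebra_simps)
  also have "\<dots> \<le> L2_norm_unit (\<lambda>p. (1 / ?H) * (g p - h p)) + L2_norm_unit (\<lambda>p. (1 / ?G - 1 / ?H) * g p)"
    by (intro L2_norm_unit_triangle square_integrable_scale g gh)
  also have "\<dots> = ?E / ?H + \<bar>1 / ?G - 1 / ?H\<bar> * ?G"
    using pos by (simp only: L2_norm_unit_scale) simp
  also have "\<bar>1 / ?G - 1 / ?H\<bar> * ?G \<le> ?E / ?H"
  proof (cases "?G = 0")
    case True
    then show ?thesis using pos L2_norm_unit_nonneg[of "\<lambda>p. g p - h p"] by simp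
  next
    case False
    then have "0 < ?G" using L2_norm_unit_nonneg[of g] by simp
    then have "\<bar>1 / ?G - 1 / ?H\<bar> * ?G = \<bar>?H - ?G\<bar> / ?H"
      using pos by (simp add: diff_frac_eq abs_mult)
    then show ?thesis using GH pos by (simp add: divide_right_mono)
  qed
  finally show ?thesis by simp
qed

section \<open>Integration over the plane\<close>

text \<open>Tonelli's theorem reduces this to the one-dimensional substitution in each
  coordinate.\<close>

lemma nn_integral_plane_affine:
  fixes F :: "real \<times> real \<Rightarrow> ennreal"
  assumes F [measurable]: "F \<in> borel_measurable borel" and c: "c \<noteq> 0" "c' \<noteq> 0"
  shows "(\<integral>\<^sup>+ p. F p \<partial>lborel)
    = ennreal \<bar>c * c'\<bar> * (\<integral>\<^sup>+ p. F (t + c * fst p, t' + c' * snd p) \<partial>lborel)"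
proof -
  have [measurable]: "F \<in> borel_measurable (borel \<Otimes>\<^sub>M borel)"
    using F by (simp add: borel_prod)
  have [measurable]: "(\<lambda>p. F (t + c * fst p, t' + c' * snd p)) \<in> borel_measurable (lborel \<Otimes>\<^sub>M lborel)"
    by measurable
  have "(\<integral>\<^sup>+ p. F p \<partial>lborel) = (\<integral>\<^sup>+ x. \<integral>\<^sup>+ y. F (x, y) \<partial>lborel \<partial>lborel)"
    by (subst lborel_prod[symmetric], subst lborel.nn_integral_fst) simp_all
  also have "\<dots> = (\<integral>\<^sup>+ x. ennreal \<bar>c'\<bar> * (\<integral>\<^sup>+ y. F (x, t' + c' * y) \<partial>lborel) \<partial>lborel)"
    by (intro nn_integral_cong nn_integral_real_affine c) measurable
  also have "\<dots> = ennreal \<bar>c\<bar> * (\<integral>\<^sup>+ x. ennreal \<bar>c'\<bar> * (\<integral>\<^sup>+ y. F (t + c * x, t' + c' * y) \<partial>lborel) \<partial>lborel)"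
    by (intro nn_integral_real_affine c) measurable
  also have "\<dots> = ennreal \<bar>c\<bar> * (ennreal \<bar>c'\<bar> * (\<integral>\<^sup>+ x. \<integral>\<^sup>+ y. F (t + c * x, t' + c' * y) \<partial>lborel \<partial>lborel))"
    by (subst nn_integral_cmult) auto
  also have "(\<integral>\<^sup>+ x. \<integral>\<^sup>+ y. F (t + c * x, t' + c' * y) \<partial>lborel \<partial>lborel)
      = (\<integral>\<^sup>+ p. F (t + c * fst p, t' + c' * snd p) \<partial>lborel)"
    by (subst lborel_prod[symmetric], subst lborel.nn_integral_fst[symmetric]) simp_all
  finally show ?thesis
    by (simp add: abs_mult ennreal_mult' mult.assoc)
qed

text \<open>Bridge from the extended-real integral inside \<open>L2_norm_plane\<close> to the
  real-valued \<open>L2_norm_unit\<close>.\<close>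

lemma nn_integral_eq_L2_norm_unit:
  assumes "square_integrable g" "\<And>p. p \<notin> unit_square \<Longrightarrow> g p = 0"
  shows "(\<integral>\<^sup>+ p. ennreal ((g p)\<^sup>2) \<partial>lborel) = ennreal ((L2_norm_unit g)\<^sup>2)"
proof -
  have "(\<integral>\<^sup>+ p. ennreal ((g p)\<^sup>2) \<partial>lborel)
      = (\<integral>\<^sup>+ p. ennreal (indicator unit_square p *\<^sub>R (g p)\<^sup>2) \<partial>lborel)"
    using assms(2) by (intro nn_integral_cong) (auto simp: indicator_def)
  also have "\<dots> = ennreal ((L2_norm_unit g)\<^sup>2)"
    using assms(1) unfolding L2_norm_unit_square square_integrable_def set_integrable_def
      set_lebesgue_integral_def
    by (intro nn_integral_eq_integral) auto
  finally show ?thesis .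
qed

text \<open>\<open>h\<close> is \<open>g\<close> pulled back from a rectangle with sides
  \<open>w\<close>, \<open>w'\<close> to the unit square, and the root of the Jacobian comes out of
  the norm. The integral is finite, so the infinite branch of \<open>L2_norm_plane\<close> does not
  arise.\<close>

lemma L2_norm_plane_affine:
  assumes g: "g \<in> borel_measurable borel" and w: "0 < w" "0 < w'"
    and h: "\<And>s s'. h (s, s') = g (t + w * s, t' + w' * s')"
    and "square_integrable h" "\<And>p. p \<notin> unit_square \<Longrightarrow> h p = 0"
  shows "L2_norm_plane g = ennreal (sqrt (w * w') * L2_norm_unit h)"
proof -
  have "(\<integral>\<^sup>+ p. ennreal ((g p)\<^sup>2) \<partial>lborel)
      = ennreal (w * w') * (\<integral>\<^sup>+ p. ennreal ((h p)\<^sup>2) \<partial>lborel)"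
    using nn_integral_plane_affine[of "\<lambda>p. ennreal ((g p)\<^sup>2)" w w' t t'] g w
    by (simp add: h[symmetric] del: ennreal_power)
  also have "\<dots> = ennreal (w * w' * (L2_norm_unit h)\<^sup>2)"
    using w by (subst nn_integral_eq_L2_norm_unit[OF assms(5,6)]) (simp_all add: ennreal_mult' del: ennreal_power)
  finally show ?thesis
    using w by (simp add: L2_norm_plane_def Let_def real_sqrt_mult L2_norm_unit_nonneg del: ennreal_power)
qed

section \<open>Templates rescaled to their supporting rectangle\<close>

text \<open>The continuous counterpart of \<open>rescaled_index\<close>: the ends of a support
  projection replace the extreme active indices, and nothing is rounded.\<close>

definition interpolate :: "real set \<Rightarrow> real \<Rightarrow> real" where
  "interpolate A t = Inf A + t * (Sup A - Inf A)"

definition x_support :: "(real \<times> real \<Rightarrow> real) \<Rightarrow> real set" where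
  "x_support f = fst ` {p. f p \<noteq> 0}"

definition y_support :: "(real \<times> real \<Rightarrow> real) \<Rightarrow> real set" where
  "y_support f = snd ` {p. f p \<noteq> 0}"

text \<open>This is the function h_f of the outline, taken on the whole plane so that substitutions
  in plane integrals apply to it.\<close>

definition standardized :: "(real \<times> real \<Rightarrow> real) \<Rightarrow> real \<times> real \<Rightarrow> real" where
  "standardized f = (\<lambda>(t, t'). f (interpolate (x_support f) t, interpolate (y_support f) t'))"

text \<open>Points of \<open>A\<close> lie between \<open>Inf A\<close> and \<open>Sup A\<close>,
  and the gap is positive. This is why \<open>standardized\<close> vanishes off the unit
  square.\<close>

lemma interpolate_mem_imp_unit:
  assumes "interpolate A t \<in> A" "A \<subseteq> {a..b}" "Inf A < Sup A"
  shows "t \<in> {0..1}"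
proof -
  have "bdd_below A" "bdd_above A"
    using assms(2) by (auto intro: bdd_below_mono bdd_above_mono)
  then have "Inf A \<le> interpolate A t" "interpolate A t \<le> Sup A"
    using assms(1) by (auto intro: cInf_lower cSup_upper)
  then have "0 \<le> t * (Sup A - Inf A)" "t * (Sup A - Inf A) \<le> 1 * (Sup A - Inf A)"
    by (simp_all add: interpolate_def)
  with assms(3) show ?thesis
    by (simp add: zero_le_mult_iff mult_le_cancel_right)
qed

text \<open>Together with a point, \<open>A\<close> contains a slightly larger one. The support
  rectangle thus has positive widths, by which one can divide.\<close>

lemma open_Inf_less_Sup:
  fixes A :: "real set"
  assumes "open A" "A \<noteq> {}" "A \<subseteq> {a..b}"
  shows "Inf A < Sup A"
proof -
  obtain x where x: "x \<in> A" using assms(2) by blast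
  obtain e where e: "e > 0" "ball x e \<subseteq> A"
    using assms(1) x openE by blast
  then have "x + e / 2 \<in> A"
    by (auto simp: dist_real_def subset_iff)
  moreover have "bdd_below A" "bdd_above A"
    using assms(3) by (auto intro: bdd_below_mono bdd_above_mono)
  ultimately have "Inf A \<le> x" "x + e / 2 \<le> Sup A"
    using x by (auto intro: cInf_lower cSup_upper)
  with e(1) show ?thesis by linarith
qed

lemma Sup_diff_Inf_le:
  fixes A :: "real set"
  assumes "A \<noteq> {}" "A \<subseteq> {a..b}"
  shows "Sup A - Inf A \<le> b - a"
proof -
  have "Sup A \<le> b" "a \<le> Inf A"
    using assms(2) by (auto intro!: cSup_least[OF assms(1)] cInf_greatest[OF assms(1)])
  then show ?thesis by linarith
qed

section \<open>Regularity and mass of a single template\<close>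

locale regular_template =
  fixes f :: "real \<times> real \<Rightarrow> real" and C :: real
  assumes is_template: "template f"
    and lipschitz: "lipschitz_template C f"
    and central: "centrally_supported f"
begin

abbreviation "wx \<equiv> Sup (x_support f) - Inf (x_support f)"
abbreviation "wy \<equiv> Sup (y_support f) - Inf (y_support f)"
abbreviation "mass \<equiv> L1_norm_unit f"

lemma nonneg: "0 \<le> f p"
  using is_template unfolding template_def by blast

lemma L1_nonneg: "0 \<le> mass"
  unfolding L1_norm_unit_def set_lebesgue_integral_def by (auto intro!: integral_nonneg_AE)

lemma lipschitzD:
  "\<bar>f p - f q\<bar> \<le> C * mass * (\<bar>fst p - fst q\<bar> + \<bar>snd p - snd q\<bar>)"
  using lipschitz unfolding lipschitz_template_def by (metis prod.collapse)

text \<open>The Lipschitz bound squeezes \<open>f p - f q\<close> to 0. Continuity supplies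
  measurability and, through the open support, positive widths.\<close>

lemma continuous: "continuous_on UNIV f"
  unfolding continuous_on
proof
  fix q :: "real \<times> real"
  have "((\<lambda>p. C * mass * (\<bar>fst p - fst q\<bar> + \<bar>snd p - snd q\<bar>)) \<longlongrightarrow>
      C * mass * (\<bar>fst q - fst q\<bar> + \<bar>snd q - snd q\<bar>)) (at q)"
    by (intro tendsto_intros)
  then have "((\<lambda>p. C * mass * (\<bar>fst p - fst q\<bar> + \<bar>snd p - snd q\<bar>)) \<longlongrightarrow> 0) (at q)"
    by simp
  then have "((\<lambda>p. f p - f q) \<longlongrightarrow> 0) (at q)"
    by (rule Lim_null_comparison[rotated]) (simp add: lipschitzD)
  then show "(f \<longlongrightarrow> f q) (at q)"
    by (simp add: LIM_zero_iff)
qed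

lemma measurable_f [measurable]: "f \<in> borel_measurable borel"
  by (rule borel_measurable_continuous_onI[OF continuous])

lemma open_support: "open {p. f p \<noteq> 0}"
  by (intro open_Collect_neq continuous continuous_on_const)

text \<open>An open set inside a closed square lies in its interior. The strict bounds later place
  preimages of the support in the half-open square covered by the pixels.\<close>

lemma support_interior:
  assumes "f (x, y) \<noteq> 0"
  shows "1/4 < x" "x < 3/4" "1/4 < y" "y < 3/4"
proof -
  have "{p. f p \<noteq> 0} \<subseteq> interior ({1/4..3/4} \<times> {1/4..3/4})"
    using central open_support unfolding centrally_supported_def by (intro interior_maximal)
  then have "(x, y) \<in> interior ({1/4..3/4} \<times> {1/4..3/4})"
    using assms by blast
  then show "1/4 < x" "x < 3/4" "1/4 < y" "y < 3/4"
    by (simp_all add: interior_Times)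
qed

text \<open>With mass 0 the Lipschitz bound would make \<open>f\<close> constant, equal to its value
  0 at the origin.\<close>

lemma L1_pos: "0 < mass"
proof (rule ccontr)
  assume "\<not> 0 < mass"
  then have "mass = 0" using L1_nonneg by simp
  then have "f p = f (0, 0)" for p
    using lipschitzD[of p "(0, 0)"] by simp
  moreover have "f (0, 0) = 0"
    using support_interior(1)[of 0 0] by auto
  ultimately show False
    using is_template by (auto simp: template_def)
qed

lemma support_projections:
  "open (x_support f)" "open (y_support f)" "x_support f \<noteq> {}" "y_support f \<noteq> {}"
  "x_support f \<subseteq> {1/4..3/4}" "y_support f \<subseteq> {1/4..3/4}"
proof -
  show "open (x_support f)" "open (y_support f)"
    unfolding x_support_def y_support_def
    by (intro open_image_fst open_image_snd open_support)+
  show "x_support f \<noteq> {}" "y_support f \<noteq> {}"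
    using is_template by (auto simp: x_support_def y_support_def template_def)
  show "x_support f \<subseteq> {1/4..3/4}" "y_support f \<subseteq> {1/4..3/4}"
    using central unfolding centrally_supported_def x_support_def y_support_def by fastforce+
qed

lemma width_pos: "0 < wx" "0 < wy"
  using open_Inf_less_Sup[OF support_projections(1,3,5)]
    open_Inf_less_Sup[OF support_projections(2,4,6)] by simp_all

lemma width_le_1: "wx \<le> 1" "wy \<le> 1"
  using Sup_diff_Inf_le[OF support_projections(3,5)] Sup_diff_Inf_le[OF support_projections(4,6)]
  by simp_all

lemma standardized_affine:
  "standardized f (s, s') = f (Inf (x_support f) + wx * s, Inf (y_support f) + wy * s')"
  by (simp add: standardized_def interpolate_def mult.commute)

lemma standardized_outside: "p \<notin> unit_square \<Longrightarrow> standardized f p = 0"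
proof (rule ccontr)
  assume p: "p \<notin> unit_square" "standardized f p \<noteq> 0"
  obtain s s' where s: "p = (s, s')" by (cases p)
  have "(interpolate (x_support f) s, interpolate (y_support f) s') \<in> {p. f p \<noteq> 0}"
    using p(2) by (simp add: s standardized_def)
  then have "interpolate (x_support f) s \<in> x_support f" "interpolate (y_support f) s' \<in> y_support f"
    unfolding x_support_def y_support_def by (metis image_eqI fst_conv snd_conv)+
  then have "s \<in> {0..1}" "s' \<in> {0..1}"
    using interpolate_mem_imp_unit support_projections(5,6) width_pos by auto
  with p(1) show False by (simp add: s unit_square_def)
qed

text \<open>Comparison with the origin, where \<open>f\<close> vanishes: the coordinates of a
  support point add up to less than 2.\<close>

lemma f_le: "f p \<le> 2 * \<bar>C\<bar> * mass"
proof (cases "f p = 0")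
  case True
  then show ?thesis using L1_nonneg by simp
next
  case False
  then have p: "1/4 < fst p" "fst p < 3/4" "1/4 < snd p" "snd p < 3/4"
    using support_interior[of "fst p" "snd p"] by simp_all
  have "f (0, 0) = 0"
    using support_interior(1)[of 0 0] by auto
  then have "f p \<le> C * mass * (\<bar>fst p\<bar> + \<bar>snd p\<bar>)"
    using lipschitzD[of p "(0, 0)"] by (simp add: abs_le_iff)
  also have "\<dots> \<le> \<bar>C\<bar> * mass * 2"
    using p L1_nonneg by (intro mult_mono) auto
  finally show ?thesis by simp
qed

lemma measurable_standardized [measurable]: "standardized f \<in> borel_measurable borel"
proof -
  have "(\<lambda>p. f (Inf (x_support f) + wx * fst p, Inf (y_support f) + wy * snd p)) \<in> borel_measurable borel"
    by (intro borel_measurable_continuous_onI continuous_on_compose2[OF continuous] continuous_intros) auto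
  then show ?thesis
    by (simp add: standardized_affine[symmetric])
qed

lemma square_integrable_standardized: "square_integrable (standardized f)"
  by (rule square_integrable_bounded[where B = "2 * \<bar>C\<bar> * mass"])
     (auto simp: standardized_affine f_le nonneg)

text \<open>This absorbs the factor \<open>mass\<close> of the Lipschitz constant. Substitution
  writes \<open>mass\<close> as \<open>wx * wy\<close> times the integral of
  \<open>standardized f\<close>; the widths are at most 1, and Cauchy-Schwarz against the constant 1
  bounds the integral.\<close>

lemma mass_le_L2: "mass \<le> L2_norm_unit (standardized f)"
proof -
  let ?h = "standardized f"
  have hpos: "0 \<le> ?h p" for p
    by (cases p) (simp add: standardized_def nonneg)
  have f0: "f p = 0" if "p \<notin> unit_square" for p
  proof (rule ccontr)
    assume "f p \<noteq> 0"
    then have "f (fst p, snd p) \<noteq> 0" by simp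
    from support_interior[OF this] that show False
      by (auto simp: unit_square_def mem_Times_iff)
  qed
  have one: "square_integrable (\<lambda>p. 1)"
    by (rule square_integrable_bounded[of _ 1]) auto
  have f_int: "set_integrable lborel unit_square f"
    using square_integrable_mult[OF square_integrable_bounded[of f "2 * \<bar>C\<bar> * mass"] one] f_le nonneg
    by simp
  have h_int: "set_integrable lborel unit_square ?h"
    using square_integrable_mult[OF square_integrable_standardized one] by simp
  have "ennreal mass = (\<integral>\<^sup>+ p. ennreal (indicator unit_square p *\<^sub>R f p) \<partial>lborel)"
    using f_int nonneg unfolding L1_norm_unit_def set_lebesgue_integral_def set_integrable_def
    by (subst nn_integral_eq_integral) auto
  also have "\<dots> = (\<integral>\<^sup>+ p. ennreal (f p) \<partial>lborel)"
    using f0 by (intro nn_integral_cong) (auto simp: indicator_def)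
  also have "\<dots> = ennreal (wx * wy) * (\<integral>\<^sup>+ p. ennreal (?h p) \<partial>lborel)"
    using width_pos nn_integral_plane_affine[of "\<lambda>p. ennreal (f p)" wx wy
      "Inf (x_support f)" "Inf (y_support f)"]
    by (simp add: standardized_affine[symmetric])
  also have "\<dots> \<le> 1 * (\<integral>\<^sup>+ p. ennreal (?h p) \<partial>lborel)"
    using width_pos width_le_1
    by (intro mult_right_mono) (auto simp: mult_le_one less_imp_le)
  also have "\<dots> = (\<integral>\<^sup>+ p. ennreal (indicator unit_square p *\<^sub>R ?h p) \<partial>lborel)"
    using standardized_outside by (auto intro!: nn_integral_cong simp: indicator_def)
  \<comment> \<open>The factor 1 gives the integrand the product form of Cauchy-Schwarz.\<close>
  also have "\<dots> = ennreal (LINT p:unit_square|lborel. ?h p * 1)"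
    using h_int hpos unfolding set_lebesgue_integral_def set_integrable_def
    by (subst nn_integral_eq_integral) auto
  finally have "mass \<le> (LINT p:unit_square|lborel. ?h p * 1)"
    by (subst (asm) ennreal_le_iff)
       (auto intro!: integral_nonneg_AE simp: hpos set_lebesgue_integral_def)
  also have "\<dots> \<le> L2_norm_unit ?h * L2_norm_unit (\<lambda>p. 1)"
    by (rule L2_norm_unit_inner_le[OF square_integrable_standardized one])
  also have "\<dots> \<le> L2_norm_unit ?h * 1"
    by (intro mult_left_mono L2_norm_unit_le_bound L2_norm_unit_nonneg) auto
  finally show ?thesis by simp
qed

lemma L2_standardized_pos: "0 < L2_norm_unit (standardized f)"
  using L1_pos mass_le_L2 by linarith

end

section \<open>Normalised templates and the separation\<close>

definition normalized :: "(real \<times> real \<Rightarrow> real) \<Rightarrow> real \<times> real \<Rightarrow> real" where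
  "normalized f p = standardized f p / L2_norm_unit (standardized f)"

text \<open>One competitor bounds the infimum: its affine map carries the support rectangle of
  \<open>g\<close> onto that of \<open>f\<close>, so on the unit square only a combination of the
  two standardized functions remains.\<close>

lemma separation_le_normalized:
  assumes "regular_template f C" "regular_template g C"
  shows "separation f g \<le> ennreal (L2_norm_unit (\<lambda>p. normalized f p - normalized g p))"
proof -
  interpret f: regular_template f C by fact
  interpret g: regular_template g C by fact
  let ?F = "standardized f" and ?G = "standardized g"
  let ?nF = "L2_norm_unit ?F" and ?nG = "L2_norm_unit ?G"
  \<comment> \<open>\<open>a\<close> makes the norms of \<open>a * ?F p\<close> and
    \<open>?G p\<close> agree, \<open>b\<close> and \<open>b'\<close> are ratios of side lengths,
    and \<open>c\<close> and \<open>c'\<close> match the lower left corners.\<close>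
  define a where "a = ?nG / ?nF"
  define b where "b = f.wx / g.wx"
  define b' where "b' = f.wy / g.wy"
  define c where "c = b * Inf (x_support g) - Inf (x_support f)"
  define c' where "c' = b' * Inf (y_support g) - Inf (y_support f)"
  let ?diff = "\<lambda>(u, v). a * f (b * u - c, b' * v - c') - g (u, v)"
  let ?h = "\<lambda>p. a * ?F p - ?G p"
  have sq: "square_integrable ?h"
    by (intro square_integrable_diff square_integrable_scale
        f.square_integrable_standardized g.square_integrable_standardized)
  have out: "?h p = 0" if "p \<notin> unit_square" for p
    using that by (simp add: f.standardized_outside g.standardized_outside)
  have "continuous_on UNIV (\<lambda>p. a * f (b * fst p - c, b' * snd p - c') - g p)"
    by (intro continuous_intros continuous_on_compose2[OF f.continuous] g.continuous) auto
  then have meas: "?diff \<in> borel_measurable borel"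
    by (simp add: case_prod_beta' borel_measurable_continuous_onI)
  have h: "?h (s, s') = ?diff (Inf (x_support g) + g.wx * s, Inf (y_support g) + g.wy * s')" for s s'
  proof -
    have "b * g.wx = f.wx" "b' * g.wy = f.wy"
      using g.width_pos by (simp_all add: b_def b'_def)
    moreover have "b * (Inf (x_support g) + g.wx * s) - c = Inf (x_support f) + (b * g.wx) * s"
      "b' * (Inf (y_support g) + g.wy * s') - c' = Inf (y_support f) + (b' * g.wy) * s'"
      by (simp_all add: c_def c'_def algebra_simps)
    ultimately have "b * (Inf (x_support g) + g.wx * s) - c = Inf (x_support f) + f.wx * s"
      "b' * (Inf (y_support g) + g.wy * s') - c' = Inf (y_support f) + f.wy * s'"
      by simp_all
    then show ?thesis
      by (simp add: f.standardized_affine g.standardized_affine)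
  qed
  let ?r = "sqrt (g.wx * g.wy)"
  have r: "0 < ?r" using g.width_pos by simp
  have nom: "L2_norm_plane ?diff = ennreal (?r * L2_norm_unit ?h)"
    by (rule L2_norm_plane_affine[OF meas g.width_pos h sq out])
  have den: "L2_norm_plane g = ennreal (?r * ?nG)"
    by (rule L2_norm_plane_affine[OF g.measurable_f g.width_pos g.standardized_affine
          g.square_integrable_standardized g.standardized_outside])
  have "separation f g \<le> L2_norm_plane ?diff / L2_norm_plane g"
    unfolding separation_def
    by (intro divide_right_mono_ennreal INF_lower2[of "(a, b, c, b', c')"]) auto
  also have "\<dots> = ennreal ((?r * L2_norm_unit ?h) / (?r * ?nG))"
    unfolding nom den using r g.L2_standardized_pos L2_norm_unit_nonneg[of ?h]
    by (intro divide_ennreal) auto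
  \<comment> \<open>The Jacobian factor \<open>?r\<close> is common to numerator and
    denominator.\<close>
  also have "(?r * L2_norm_unit ?h) / (?r * ?nG) = L2_norm_unit (\<lambda>p. (1 / ?nG) * ?h p)"
    unfolding L2_norm_unit_scale mult_divide_mult_cancel_left[OF less_imp_neq[OF r, symmetric]]
    using g.L2_standardized_pos by simp
  also have "(\<lambda>p. (1 / ?nG) * ?h p) = (\<lambda>p. normalized f p - normalized g p)"
    using f.L2_standardized_pos g.L2_standardized_pos
    by (auto simp: normalized_def a_def field_simps)
  finally show ?thesis .
qed

section \<open>Pixels\<close>

lemma pixel_cell_borel [measurable]: "pixel_cell d j l \<in> sets borel"
  unfolding pixel_cell_def by (intro borel_Times) auto

lemma emeasure_pixel_cell:
  assumes "d \<ge> 1"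
  shows "emeasure lborel (pixel_cell d j l) = ennreal (1 / (real d)\<^sup>2)"
proof -
  have "emeasure lborel (pixel_cell d j l)
      = emeasure (lborel \<Otimes>\<^sub>M lborel) ({(real j - 1) / real d ..< real j / real d} \<times> {(real l - 1) / real d ..< real l / real d})"
    by (simp add: lborel_prod pixel_cell_def)
  also have "\<dots> = ennreal (1 / real d) * ennreal (1 / real d)"
    by (subst lborel.emeasure_pair_measure_Times) (auto simp: diff_divide_distrib)
  finally show ?thesis
    by (simp add: ennreal_mult'[symmetric] power2_eq_square)
qed

lemma set_integrable_pixel_cell:
  fixes g :: "real \<times> real \<Rightarrow> real"
  assumes "continuous_on UNIV g"
  shows "set_integrable lborel (pixel_cell d j l) g"
proof (rule set_integrable_subset)
  let ?B = "cbox ((real j - 1) / real d, (real l - 1) / real d) (real j / real d, real l / real d)"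
  show "set_integrable lborel ?B g"
    unfolding set_integrable_def
    using assms by (intro borel_integrable_compact) (auto intro: continuous_on_subset)
  show "pixel_cell d j l \<subseteq> ?B"
    by (auto simp: pixel_cell_def cbox_Pair_eq)
qed simp

text \<open>\<open>(real d)\<^sup>2\<close> is the reciprocal of the cell area, so the claim
  concerns the average of \<open>g\<close> over the cell, which inherits a uniform bound.\<close>

lemma pixel_average_approx:
  fixes g :: "real \<times> real \<Rightarrow> real"
  assumes d: "d \<ge> 1" and g: "continuous_on UNIV g"
    and le: "\<And>p. p \<in> pixel_cell d j l \<Longrightarrow> \<bar>g p - c\<bar> \<le> \<epsilon>"
  shows "\<bar>(real d)\<^sup>2 * (LINT p:pixel_cell d j l|lborel. g p) - c\<bar> \<le> \<epsilon>"
proof -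
  let ?I = "\<lambda>w. LINT p:pixel_cell d j l|lborel. w p :: real"
  have const: "?I (\<lambda>p. x) = x / (real d)\<^sup>2" for x
    by (simp add: set_lebesgue_integral_def measure_def emeasure_pixel_cell[OF d])
  have int: "set_integrable lborel (pixel_cell d j l) (\<lambda>p. x)" for x :: real
    by (intro set_integrable_pixel_cell continuous_on_const)
  have "?I (\<lambda>p. c - \<epsilon>) \<le> ?I g" "?I g \<le> ?I (\<lambda>p. c + \<epsilon>)"
    using le by (auto intro!: set_integral_mono int set_integrable_pixel_cell g simp: abs_le_iff)
      (smt (verit))+
  with d show ?thesis
    by (simp add: const abs_le_iff field_simps)
qed

text \<open>Turns the positivity test for active pixels into a geometric one. By continuity a single
  nonzero value in the cell yields a nonempty open set of them, which is not a null set.\<close>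

lemma pixel_integral_pos_iff:
  fixes g :: "real \<times> real \<Rightarrow> real"
  assumes d: "d \<ge> 1" and g: "continuous_on UNIV g" and nonneg: "\<And>p. 0 \<le> g p"
  shows "0 < (LINT p:pixel_cell d j l|lborel. g p) \<longleftrightarrow> (\<exists>p\<in>pixel_cell d j l. g p \<noteq> 0)"
proof
  assume pos: "0 < (LINT p:pixel_cell d j l|lborel. g p)"
  show "\<exists>p\<in>pixel_cell d j l. g p \<noteq> 0"
  proof (rule ccontr)
    assume "\<not> ?thesis"
    then have "(LINT p:pixel_cell d j l|lborel. g p) = (LINT p:pixel_cell d j l|lborel. 0)"
      by (intro set_lebesgue_integral_cong) auto
    with pos show False
      by (simp add: set_lebesgue_integral_def)
  qed
next
  assume "\<exists>p\<in>pixel_cell d j l. g p \<noteq> 0"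
  then obtain p where p: "p \<in> pixel_cell d j l" "g p \<noteq> 0" by blast
  let ?box = "{(real j - 1) / real d <..< real j / real d} \<times> {(real l - 1) / real d <..< real l / real d}"
  let ?U = "{p. g p \<noteq> 0}"
  have U: "open ?U"
    by (intro open_Collect_neq g continuous_on_const)
  \<comment> \<open>The cell is half-open, so \<open>p\<close> may lie on its edge; as a point of
    the closure it still has nearby points of \<open>?U\<close> inside the open box.\<close>
  have "p \<in> closure ?box"
    using p(1) d by (auto simp: closure_Times pixel_cell_def divide_strict_right_mono)
  then have "?U \<inter> ?box \<noteq> {}"
    using p(2) open_Int_closure_eq_empty[OF U, of ?box] by blast
  moreover have V: "open (?U \<inter> ?box)"
    by (intro open_Int U open_Times) auto
  ultimately have "\<not> negligible (?U \<inter> ?box)"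
    by (rule open_not_negligible[rotated])
  then have "?U \<inter> ?box \<notin> null_sets lborel"
    using null_sets_completionI negligible_iff_null_sets by blast
  then have not_AE: "\<not> (AE x in lborel. x \<notin> ?U \<inter> ?box)"
    using V by (subst AE_iff_null_sets[symmetric]) auto
  have "0 \<le> (LINT p:pixel_cell d j l|lborel. g p)"
    unfolding set_lebesgue_integral_def by (intro Bochner_Integration.integral_nonneg) (simp add: nonneg)
  moreover have "(LINT p:pixel_cell d j l|lborel. g p) \<noteq> 0"
  proof
    assume "(LINT p:pixel_cell d j l|lborel. g p) = 0"
    moreover have nn: "0 \<le> indicator (pixel_cell d j l) x *\<^sub>R g x" for x
      by (simp add: nonneg)
    ultimately have "AE x in lborel. indicator (pixel_cell d j l) x *\<^sub>R g x = 0"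
      using set_integrable_pixel_cell[OF g, of d j l]
      unfolding set_lebesgue_integral_def set_integrable_def
      by (subst (asm) integral_nonneg_eq_0_iff_AE) (use nn in \<open>simp_all only: AE_I2\<close>)
    then have "AE x in lborel. x \<notin> ?U \<inter> ?box"
      by eventually_elim (auto simp: pixel_cell_def indicator_def)
    with not_AE show False by contradiction
  qed
  ultimately show "0 < (LINT p:pixel_cell d j l|lborel. g p)" by simp
qed

section \<open>Discretised rescaling of one coordinate\<close>

text \<open>Let \<open>e = \<xi> / real d\<close> be the pixel width in template coordinates. The
  extreme indices locate \<open>Inf A\<close> and \<open>Sup A\<close> up to \<open>e\<close>, and
  convex combination keeps this error. Rounding the index and the position of \<open>u\<close> in
  its cell cost at most \<open>e\<close> each, on the same side, and the difference ends up between
  \<open>- 2 * e\<close> and \<open>e\<close>.\<close>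

lemma rescaled_index_close:
  fixes A :: "real set" and d :: nat
  assumes S: "finite S" "S \<noteq> {}" and d: "d \<ge> 1" and \<xi>: "0 < \<xi>"
    and meets: "\<And>j. j \<in> S \<Longrightarrow> \<exists>x\<in>A. \<xi> * ((real j - 1) / real d) - \<tau> \<le> x \<and> x \<le> \<xi> * (real j / real d) - \<tau>"
    and covers: "\<And>x. x \<in> A \<Longrightarrow> \<exists>j\<in>S. \<xi> * ((real j - 1) / real d) - \<tau> \<le> x \<and> x \<le> \<xi> * (real j / real d) - \<tau>"
    and t: "t \<in> {0..1}"
    and u: "(real (rescaled_index S t) - 1) / real d \<le> u" "u \<le> real (rescaled_index S t) / real d"
  shows "\<bar>\<xi> * u - \<tau> - interpolate A t\<bar> \<le> 2 * \<xi> / real d"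
proof -
  let ?m = "real (Min S)" and ?M = "real (Max S)"
  define e where "e = \<xi> / real d"
  have e: "0 < e" using \<xi> d by (simp add: e_def)
  have edge: "\<xi> * ((real j - 1) / real d) - \<tau> = e * real j - \<tau> - e"
    "\<xi> * (real j / real d) - \<tau> = e * real j - \<tau>" for j
    by (simp_all add: e_def diff_divide_distrib right_diff_distrib)
  have bounds: "e * ?m - \<tau> - e \<le> x" "x \<le> e * ?M - \<tau>" if x: "x \<in> A" for x
  proof -
    obtain j where j: "j \<in> S" "e * real j - \<tau> - e \<le> x" "x \<le> e * real j - \<tau>"
      using covers[OF x] unfolding edge by blast
    have "e * ?m \<le> e * real j" "e * real j \<le> e * ?M"
      using e S j(1) by simp_all
    with j show "e * ?m - \<tau> - e \<le> x" "x \<le> e * ?M - \<tau>" by linarith+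
  qed
  have bdd: "bdd_below A" "bdd_above A"
    by (rule bdd_belowI, erule bounds, rule bdd_aboveI, erule bounds)
  obtain x where x: "x \<in> A" "x \<le> e * ?m - \<tau>"
    using meets[of "Min S"] S unfolding edge by auto
  obtain x' where x': "x' \<in> A" "e * ?M - \<tau> - e \<le> x'"
    using meets[of "Max S"] S unfolding edge by auto
  have inf: "e * ?m - \<tau> - e \<le> Inf A" "Inf A \<le> e * ?m - \<tau>"
    using cInf_greatest[OF _ bounds(1)] cInf_lower2[OF x bdd(1)] x(1) by auto
  have sup: "e * ?M - \<tau> - e \<le> Sup A" "Sup A \<le> e * ?M - \<tau>"
    using cSup_least[OF _ bounds(2)] cSup_upper2[OF x' bdd(2)] x'(1) by auto
  \<comment> \<open>\<open>s\<close> is the selected index before rounding. For \<open>t\<close> in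
    the unit interval the bounds at both ends of \<open>A\<close> combine with nonnegative
    weights.\<close>
  define s where "s = ?m + t * (?M - ?m)"
  have convex: "interpolate A t = (1 - t) * Inf A + t * Sup A"
    by (simp add: interpolate_def algebra_simps)
  have es: "e * s - \<tau> = (1 - t) * (e * ?m - \<tau>) + t * (e * ?M - \<tau>)"
    by (simp add: s_def algebra_simps)
  have es': "e * s - \<tau> - e = (1 - t) * (e * ?m - \<tau> - e) + t * (e * ?M - \<tau> - e)"
    by (simp add: s_def algebra_simps)
  have y1: "e * s - \<tau> - e \<le> interpolate A t"
    unfolding convex es' using t inf sup by (intro add_mono mult_left_mono) simp_all
  have y2: "interpolate A t \<le> e * s - \<tau>"
    unfolding convex es using t inf sup by (intro add_mono mult_left_mono) simp_all
  \<comment> \<open>Nonnegativity keeps \<open>nat\<close> from truncating the floor.\<close>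
  have "0 \<le> s"
    using t S by (simp add: s_def)
  then have J: "real (rescaled_index S t) \<le> s" "s \<le> real (rescaled_index S t) + 1"
    unfolding rescaled_index_def s_def[symmetric] by (simp_all add: of_nat_nat)
  have "e * real (rescaled_index S t) - e \<le> \<xi> * u" "\<xi> * u \<le> e * real (rescaled_index S t)"
    using mult_left_mono[OF u(1), of \<xi>] mult_left_mono[OF u(2), of \<xi>] \<xi>
    by (simp_all add: e_def diff_divide_distrib right_diff_distrib)
  moreover have "e * real (rescaled_index S t) \<le> e * s" "e * s \<le> e * real (rescaled_index S t) + e"
    using mult_left_mono[OF J(1), of e] mult_left_mono[OF J(2), of e] e
    by (simp_all add: distrib_left)
  moreover have "2 * \<xi> / real d = 2 * e"
    by (simp add: e_def)
  ultimately show ?thesis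
    using y1 y2 by linarith
qed

lemma measurable_rescaled_index [measurable]: "rescaled_index S \<in> borel \<rightarrow>\<^sub>M count_space UNIV"
  unfolding rescaled_index_def by measurable

text \<open>The index maps are measurable into a countable discrete space, so composition with an
  arbitrary array \<open>X\<close> stays measurable.\<close>

lemma measurable_aligned: "aligned d X \<in> borel_measurable borel"
proof -
  have "(\<lambda>p. X (rescaled_index (active_rows d X) (fst p)) (rescaled_index (active_cols d X) (snd p)))
      \<in> borel_measurable (borel \<Otimes>\<^sub>M borel)"
    by measurable
  then show ?thesis
    by (simp add: aligned_def case_prod_beta' borel_prod)
qed

section \<open>Images generated by the model\<close>

text \<open>\<open>\<Xi>\<close> is any common upper bound of the scalings, so one value can serve
  all images and give them the same error bound.\<close>

locale deformed_template = regular_template +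
  fixes d :: nat and \<eta> \<xi> \<xi>' \<tau> \<tau>' \<Xi> :: real
  assumes d_ge_1: "d \<ge> 1" and \<eta>_pos: "\<eta> > 0" and C_pos: "C > 0"
    and admissible: "admissible_deformation \<xi> \<xi>' \<tau> \<tau>'"
    and \<Xi>_ge: "\<xi> \<le> \<Xi>" "\<xi>' \<le> \<Xi>"
begin

abbreviation "g \<equiv> \<lambda>p. f (\<xi> * fst p - \<tau>, \<xi>' * snd p - \<tau>')"
abbreviation "X \<equiv> model_image d f \<eta> \<xi> \<xi>' \<tau> \<tau>'"
abbreviation "row_set \<equiv> active_rows d X"
abbreviation "col_set \<equiv> active_cols d X"

lemma scale_pos: "0 < \<xi>" "0 < \<xi>'"
  using admissible by (simp_all add: admissible_deformation_def)

lemma continuous_g: "continuous_on UNIV g"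
  by (intro continuous_on_compose2[OF continuous] continuous_intros) auto

lemma pixel_pos_iff: "0 < X j l \<longleftrightarrow> (\<exists>p\<in>pixel_cell d j l. g p \<noteq> 0)"
proof -
  have "0 < (real d)\<^sup>2 * \<eta>"
    using d_ge_1 \<eta>_pos by simp
  then have "0 < X j l \<longleftrightarrow> 0 < (LINT p:pixel_cell d j l|lborel. g p)"
    unfolding model_image_def using mult_less_cancel_left_pos[of _ 0] by fastforce
  also have "\<dots> \<longleftrightarrow> (\<exists>p\<in>pixel_cell d j l. g p \<noteq> 0)"
    by (rule pixel_integral_pos_iff[OF d_ge_1 continuous_g nonneg])
  finally show ?thesis .
qed

lemma pixel_index:
  assumes "0 \<le> u" "u < 1"
  obtains j where "j \<in> {1..d}" "(real j - 1) / real d \<le> u" "u < real j / real d"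
proof
  \<comment> \<open>Pixel indices start at 1, hence the shift of the floor; \<open>u < 1\<close>
    keeps the index at most \<open>d\<close>.\<close>
  let ?j = "nat \<lfloor>real d * u\<rfloor> + 1"
  have "real (nat \<lfloor>real d * u\<rfloor>) = of_int \<lfloor>real d * u\<rfloor>"
    using assms by (simp add: of_nat_nat)
  then have j: "real ?j - 1 \<le> real d * u" "real d * u < real ?j"
    by (simp_all; linarith)+
  then show "(real ?j - 1) / real d \<le> u" "u < real ?j / real d"
    using d_ge_1 by (simp_all add: field_simps)
  have "real d * u < real d"
    using assms d_ge_1 by simp
  with j(1) have "real ?j - 1 < real d" by linarith
  then show "?j \<in> {1..d}" by simp
qed

text \<open>A positive pixel contains a point where \<open>g\<close> is nonzero, and the deformation
  maps it to a support point. These facts and \<open>active_covers\<close> provide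
  \<open>meets\<close> and \<open>covers\<close> in \<open>rescaled_index_close\<close>.\<close>

lemma active_meets:
  "j \<in> row_set \<Longrightarrow> \<exists>x\<in>x_support f. \<xi> * ((real j - 1) / real d) - \<tau> \<le> x \<and> x \<le> \<xi> * (real j / real d) - \<tau>"
  "l \<in> col_set \<Longrightarrow> \<exists>y\<in>y_support f. \<xi>' * ((real l - 1) / real d) - \<tau>' \<le> y \<and> y \<le> \<xi>' * (real l / real d) - \<tau>'"
proof -
  have witness: "\<exists>x\<in>x_support f. \<xi> * ((real j - 1) / real d) - \<tau> \<le> x \<and> x \<le> \<xi> * (real j / real d) - \<tau>"
    "\<exists>y\<in>y_support f. \<xi>' * ((real l - 1) / real d) - \<tau>' \<le> y \<and> y \<le> \<xi>' * (real l / real d) - \<tau>'"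
    if pos: "0 < X j l" for j l
  proof -
    obtain u v where uv: "(u, v) \<in> pixel_cell d j l" "f (\<xi> * u - \<tau>, \<xi>' * v - \<tau>') \<noteq> 0"
      using pos unfolding pixel_pos_iff by fastforce
    then have "\<xi> * u - \<tau> \<in> x_support f" "\<xi>' * v - \<tau>' \<in> y_support f"
      by (force simp: x_support_def y_support_def)+
    moreover have "\<xi> * ((real j - 1) / real d) \<le> \<xi> * u" "\<xi> * u \<le> \<xi> * (real j / real d)"
      "\<xi>' * ((real l - 1) / real d) \<le> \<xi>' * v" "\<xi>' * v \<le> \<xi>' * (real l / real d)"
      using uv(1) scale_pos by (intro mult_left_mono; simp add: pixel_cell_def)+
    ultimately show "\<exists>x\<in>x_support f. \<xi> * ((real j - 1) / real d) - \<tau> \<le> x \<and> x \<le> \<xi> * (real j / real d) - \<tau>"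
      "\<exists>y\<in>y_support f. \<xi>' * ((real l - 1) / real d) - \<tau>' \<le> y \<and> y \<le> \<xi>' * (real l / real d) - \<tau>'"
      by (meson diff_right_mono)+
  qed
  show "j \<in> row_set \<Longrightarrow> \<exists>x\<in>x_support f. \<xi> * ((real j - 1) / real d) - \<tau> \<le> x \<and> x \<le> \<xi> * (real j / real d) - \<tau>"
    unfolding active_rows_def using witness(1) by blast
  show "l \<in> col_set \<Longrightarrow> \<exists>y\<in>y_support f. \<xi>' * ((real l - 1) / real d) - \<tau>' \<le> y \<and> y \<le> \<xi>' * (real l / real d) - \<tau>'"
    unfolding active_cols_def using witness(2) by blast
qed

text \<open>The admissibility bounds put the preimage of a support point into the half-open unit
  square, so some pixel contains it and is active.\<close>

lemma support_point_pixel: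
  assumes "f (x, y) \<noteq> 0"
  obtains j l where "j \<in> row_set" "l \<in> col_set"
    "\<xi> * ((real j - 1) / real d) - \<tau> \<le> x" "x \<le> \<xi> * (real j / real d) - \<tau>"
    "\<xi>' * ((real l - 1) / real d) - \<tau>' \<le> y" "y \<le> \<xi>' * (real l / real d) - \<tau>'"
proof -
  define u where "u = (x + \<tau>) / \<xi>"
  define v where "v = (y + \<tau>') / \<xi>'"
  have xy: "x = \<xi> * u - \<tau>" "y = \<xi>' * v - \<tau>'"
    using scale_pos by (simp_all add: u_def v_def)
  have "0 \<le> u" "u < 1" "0 \<le> v" "v < 1"
    using support_interior[OF assms] admissible scale_pos
    by (simp_all add: u_def v_def admissible_deformation_def)
  then obtain j l where
    j: "j \<in> {1..d}" "(real j - 1) / real d \<le> u" "u < real j / real d" and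
    l: "l \<in> {1..d}" "(real l - 1) / real d \<le> v" "v < real l / real d"
    by (metis pixel_index)
  have "(u, v) \<in> pixel_cell d j l"
    using j l by (simp add: pixel_cell_def)
  moreover have "g (u, v) \<noteq> 0"
    using assms xy by simp
  ultimately have "0 < X j l"
    unfolding pixel_pos_iff by blast
  then have "j \<in> row_set" "l \<in> col_set"
    using j(1) l(1) by (auto simp: active_rows_def active_cols_def)
  then show ?thesis
    using j l scale_pos
    by (intro that[of j l]; (simp only: xy, intro diff_right_mono mult_left_mono)?; simp)
qed

lemma active_finite: "finite row_set" "finite col_set"
  by (simp_all add: active_rows_def active_cols_def)

lemma active_nonempty: "row_set \<noteq> {}" "col_set \<noteq> {}"
proof -
  obtain x y where "f (x, y) \<noteq> 0"
    using is_template by (auto simp: template_def)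
  then show "row_set \<noteq> {}" "col_set \<noteq> {}"
    using support_point_pixel by blast+
qed

lemma active_covers:
  "x \<in> x_support f \<Longrightarrow> \<exists>j\<in>row_set. \<xi> * ((real j - 1) / real d) - \<tau> \<le> x \<and> x \<le> \<xi> * (real j / real d) - \<tau>"
  "y \<in> y_support f \<Longrightarrow> \<exists>l\<in>col_set. \<xi>' * ((real l - 1) / real d) - \<tau>' \<le> y \<and> y \<le> \<xi>' * (real l / real d) - \<tau>'"
proof -
  show "\<exists>j\<in>row_set. \<xi> * ((real j - 1) / real d) - \<tau> \<le> x \<and> x \<le> \<xi> * (real j / real d) - \<tau>"
    if x: "x \<in> x_support f"
  proof -
    from x obtain y where "f (x, y) \<noteq> 0" by (auto simp: x_support_def)
    then show ?thesis using support_point_pixel by blast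
  qed
  show "\<exists>l\<in>col_set. \<xi>' * ((real l - 1) / real d) - \<tau>' \<le> y \<and> y \<le> \<xi>' * (real l / real d) - \<tau>'"
    if y: "y \<in> y_support f"
  proof -
    from y obtain x where "f (x, y) \<noteq> 0" by (auto simp: y_support_def)
    then show ?thesis using support_point_pixel by blast
  qed
qed

text \<open>Points of the selected cell miss the interpolated point by at most
  \<open>2 * \<Xi> / real d\<close> in each coordinate. The Lipschitz bound converts the sum of
  these errors, and averaging over the cell preserves it.\<close>

lemma aligned_approx:
  assumes "p \<in> unit_square"
  shows "\<bar>aligned d X p - \<eta> * standardized f p\<bar> \<le> \<eta> * (C * mass * (4 * \<Xi> / real d))"
proof -
  obtain t t' where p: "p = (t, t')" "t \<in> {0..1}" "t' \<in> {0..1}"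
    using assms by (auto simp: unit_square_def)
  let ?J = "rescaled_index row_set t" and ?L = "rescaled_index col_set t'"
  let ?I = "LINT q:pixel_cell d ?J ?L|lborel. g q"
  have "\<bar>(real d)\<^sup>2 * ?I - standardized f p\<bar> \<le> C * mass * (4 * \<Xi> / real d)"
  proof (rule pixel_average_approx[OF d_ge_1 continuous_g])
    fix q assume "q \<in> pixel_cell d ?J ?L"
    then have q: "(real ?J - 1) / real d \<le> fst q" "fst q \<le> real ?J / real d"
      "(real ?L - 1) / real d \<le> snd q" "snd q \<le> real ?L / real d"
      by (auto simp: pixel_cell_def)
    have "\<bar>\<xi> * fst q - \<tau> - interpolate (x_support f) t\<bar> \<le> 2 * \<xi> / real d"
      by (rule rescaled_index_close[OF active_finite(1) active_nonempty(1) d_ge_1 scale_pos(1)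
            active_meets(1) active_covers(1) p(2) q(1,2)])
    moreover have "\<bar>\<xi>' * snd q - \<tau>' - interpolate (y_support f) t'\<bar> \<le> 2 * \<xi>' / real d"
      by (rule rescaled_index_close[OF active_finite(2) active_nonempty(2) d_ge_1 scale_pos(2)
            active_meets(2) active_covers(2) p(3) q(3,4)])
    moreover have "2 * \<xi> / real d + 2 * \<xi>' / real d \<le> 4 * \<Xi> / real d"
      using \<Xi>_ge by (simp add: add_divide_distrib[symmetric] divide_right_mono)
    ultimately have "\<bar>\<xi> * fst q - \<tau> - interpolate (x_support f) t\<bar>
        + \<bar>\<xi>' * snd q - \<tau>' - interpolate (y_support f) t'\<bar> \<le> 4 * \<Xi> / real d"
      by linarith
    then have "C * mass * (\<bar>\<xi> * fst q - \<tau> - interpolate (x_support f) t\<bar>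
        + \<bar>\<xi>' * snd q - \<tau>' - interpolate (y_support f) t'\<bar>) \<le> C * mass * (4 * \<Xi> / real d)"
      using C_pos L1_nonneg by (intro mult_left_mono) auto
    then show "\<bar>g q - standardized f p\<bar> \<le> C * mass * (4 * \<Xi> / real d)"
      using lipschitzD[of "(\<xi> * fst q - \<tau>, \<xi>' * snd q - \<tau>')"
          "(interpolate (x_support f) t, interpolate (y_support f) t')"]
      by (simp add: p(1) standardized_def)
  qed
  then have "\<eta> * \<bar>(real d)\<^sup>2 * ?I - standardized f p\<bar> \<le> \<eta> * (C * mass * (4 * \<Xi> / real d))"
    using \<eta>_pos by (intro mult_left_mono) auto
  moreover have "aligned d X p - \<eta> * standardized f p = \<eta> * ((real d)\<^sup>2 * ?I - standardized f p)"
    by (simp add: p(1) aligned_def model_image_def algebra_simps)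
  ultimately show ?thesis
    using \<eta>_pos by (simp add: abs_mult)
qed

section \<open>Normalisation of the aligned image\<close>

lemma square_integrable_aligned: "square_integrable (aligned d X)"
proof -
  have "square_integrable (\<lambda>p. aligned d X p - \<eta> * standardized f p)"
    using aligned_approx measurable_aligned measurable_standardized
    by (intro square_integrable_bounded borel_measurable_diff borel_measurable_times) auto
  from square_integrable_add[OF this square_integrable_scale[OF square_integrable_standardized, of \<eta>]]
  show ?thesis by simp
qed

lemma square_integrable_transform: "square_integrable (alignment_transform d X)"
  using square_integrable_scale[OF square_integrable_aligned, of "1 / L2_norm_unit (aligned d X)"]
  by (simp add: alignment_transform_def)

lemma square_integrable_normalized: "square_integrable (normalized f)"
  using square_integrable_scale[OF square_integrable_standardized, of "1 / L2_norm_unit (standardized f)"]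
  by (simp add: normalized_def[abs_def])

text \<open>Normalising cancels the brightness \<open>\<eta>\<close> and at most doubles the
  relative error, which turns the constant 4 into 8; \<open>mass_le_L2\<close> bounds the remaining
  quotient by 1.\<close>

lemma transform_approx:
  "L2_norm_unit (\<lambda>p. alignment_transform d X p - normalized f p) \<le> 8 * C * \<Xi> / real d"
proof -
  let ?Z = "aligned d X" and ?H = "\<lambda>p. \<eta> * standardized f p"
  let ?nh = "L2_norm_unit (standardized f)" and ?E = "C * mass * (4 * \<Xi> / real d)"
  have nH: "L2_norm_unit ?H = \<eta> * ?nh"
    using \<eta>_pos by (simp add: L2_norm_unit_scale)
  have \<Xi>: "0 \<le> \<Xi>"
    using scale_pos \<Xi>_ge by linarith
  have "L2_norm_unit (\<lambda>p. alignment_transform d X p - normalized f p)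
      = L2_norm_unit (\<lambda>p. ?Z p / L2_norm_unit ?Z - ?H p / L2_norm_unit ?H)"
    using \<eta>_pos unfolding nH by (simp add: alignment_transform_def normalized_def)
  also have "\<dots> \<le> 2 * L2_norm_unit (\<lambda>p. ?Z p - ?H p) / L2_norm_unit ?H"
    using \<eta>_pos L2_standardized_pos
    by (intro L2_norm_unit_normalized_diff_le square_integrable_aligned square_integrable_scale
        square_integrable_standardized) (simp add: nH)
  also have "\<dots> \<le> 2 * (\<eta> * ?E) / (\<eta> * ?nh)"
    unfolding nH using \<eta>_pos L2_standardized_pos aligned_approx measurable_aligned measurable_standardized
    by (intro divide_right_mono mult_left_mono L2_norm_unit_le_bound borel_measurable_diff
        borel_measurable_times) auto
  also have "\<dots> = (8 * C * \<Xi> / real d) * (mass / ?nh)"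
    using \<eta>_pos by simp
  also have "\<dots> \<le> (8 * C * \<Xi> / real d) * 1"
    using mass_le_L2 L2_standardized_pos C_pos \<Xi> by (intro mult_left_mono) auto
  finally show ?thesis by simp
qed

end

section \<open>Classification by the nearest transform\<close>

lemma max_separation_le_normalized:
  assumes "regular_template f C" "regular_template g C"
  shows "max_separation f g \<le> ennreal (L2_norm_unit (\<lambda>p. normalized f p - normalized g p))"
  using separation_le_normalized[OF assms] separation_le_normalized[OF assms(2,1)]
  by (simp add: max_separation_def L2_norm_unit_minus_commute[of "normalized g"])

theorem theorem3p7:
  shows "\<exists>K::real. K > 0 \<and>
    (\<forall>(d::nat) (n::nat) (f :: nat \<Rightarrow> real \<times> real \<Rightarrow> real) (C\<^sub>L::real)
      (k::nat) (\<eta>::real) (\<xi>::real) (\<xi>'::real) (\<tau>::real) (\<tau>'::real)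
      (ks :: nat \<Rightarrow> nat) (\<eta>s :: nat \<Rightarrow> real) (\<xi>s :: nat \<Rightarrow> real) (\<xi>s' :: nat \<Rightarrow> real)
      (\<tau>s :: nat \<Rightarrow> real) (\<tau>s' :: nat \<Rightarrow> real)
      (X :: image) (Xs :: nat \<Rightarrow> image) (\<Xi>::real) (i::nat).
        d \<ge> 1 \<longrightarrow>
        template (f 0) \<longrightarrow> template (f 1) \<longrightarrow>
        k \<in> {0, 1} \<longrightarrow> (\<forall>i\<in>{1..n}. ks i \<in> {0, 1}) \<longrightarrow>
        \<eta> > 0 \<longrightarrow> (\<forall>i\<in>{1..n}. \<eta>s i > 0) \<longrightarrow>
        X = model_image d (f k) \<eta> \<xi> \<xi>' \<tau> \<tau>' \<longrightarrow>
        (\<forall>i\<in>{1..n}. Xs i = model_image d (f (ks i)) (\<eta>s i) (\<xi>s i) (\<xi>s' i) (\<tau>s i) (\<tau>s' i)) \<longrightarrow>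
        {i \<in> {1..n}. ks i = 0} \<noteq> {} \<longrightarrow> {i \<in> {1..n}. ks i = 1} \<noteq> {} \<longrightarrow>
        C\<^sub>L > 0 \<longrightarrow> lipschitz_template C\<^sub>L (f 0) \<longrightarrow> lipschitz_template C\<^sub>L (f 1) \<longrightarrow>
        centrally_supported (f 0) \<longrightarrow> centrally_supported (f 1) \<longrightarrow>
        admissible_deformation \<xi> \<xi>' \<tau> \<tau>' \<longrightarrow>
        (\<forall>i\<in>{1..n}. admissible_deformation (\<xi>s i) (\<xi>s' i) (\<tau>s i) (\<tau>s' i)) \<longrightarrow>
        \<Xi> = Max ({1, \<xi>, \<xi>'} \<union> \<xi>s ` {1..n} \<union> \<xi>s' ` {1..n}) \<longrightarrow>
        max_separation (f 0) (f 1) > ennreal (4 * K * max C\<^sub>L (C\<^sub>L\<^sup>2) * \<Xi>\<^sup>2 / real d) \<longrightarrow>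
        is_alignment_index d n Xs X i \<longrightarrow>
        ks i = k)"
proof (intro exI[of _ "8::real"] conjI allI impI)
  fix d n :: nat and f :: "nat \<Rightarrow> real \<times> real \<Rightarrow> real" and C\<^sub>L :: real
    and k :: nat and \<eta> \<xi> \<xi>' \<tau> \<tau>' :: real
    and ks :: "nat \<Rightarrow> nat" and \<eta>s \<xi>s \<xi>s' \<tau>s \<tau>s' :: "nat \<Rightarrow> real"
    and X :: image and Xs :: "nat \<Rightarrow> image" and \<Xi> :: real and i :: nat
  assume d: "d \<ge> 1" and f: "template (f 0)" "template (f 1)"
    and k: "k \<in> {0, 1}" and ks: "\<forall>i\<in>{1..n}. ks i \<in> {0, 1}"
    and \<eta>: "\<eta> > 0" and \<eta>s: "\<forall>i\<in>{1..n}. \<eta>s i > 0"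
    and X: "X = model_image d (f k) \<eta> \<xi> \<xi>' \<tau> \<tau>'"
    and Xs: "\<forall>i\<in>{1..n}. Xs i = model_image d (f (ks i)) (\<eta>s i) (\<xi>s i) (\<xi>s' i) (\<tau>s i) (\<tau>s' i)"
    and both: "{i \<in> {1..n}. ks i = 0} \<noteq> {}" "{i \<in> {1..n}. ks i = 1} \<noteq> {}"
    and C: "C\<^sub>L > 0" and lip: "lipschitz_template C\<^sub>L (f 0)" "lipschitz_template C\<^sub>L (f 1)"
    and central: "centrally_supported (f 0)" "centrally_supported (f 1)"
    and adm: "admissible_deformation \<xi> \<xi>' \<tau> \<tau>'"
    and adms: "\<forall>i\<in>{1..n}. admissible_deformation (\<xi>s i) (\<xi>s' i) (\<tau>s i) (\<tau>s' i)"
    and \<Xi>: "\<Xi> = Max ({1, \<xi>, \<xi>'} \<union> \<xi>s ` {1..n} \<union> \<xi>s' ` {1..n})"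
    and sep: "max_separation (f 0) (f 1) > ennreal (4 * 8 * max C\<^sub>L (C\<^sub>L\<^sup>2) * \<Xi>\<^sup>2 / real d)"
    and i: "is_alignment_index d n Xs X i"
  let ?T = "alignment_transform d" and ?N = "\<lambda>k. normalized (f k)"
  \<comment> \<open>\<open>?B\<close> is the error from \<open>transform_approx\<close>. The final
    comparison collects four such errors, which the threshold with \<open>K = 8\<close>
    dominates.\<close>
  let ?B = "8 * C\<^sub>L * \<Xi> / real d"
  have \<Xi>_ge: "x \<le> \<Xi>" if "x \<in> {1, \<xi>, \<xi>'} \<union> \<xi>s ` {1..n} \<union> \<xi>s' ` {1..n}" for x
    unfolding \<Xi> using that by (intro Max_ge) auto
  have reg: "regular_template (f c) C\<^sub>L" if "c \<in> {0, 1}" for c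
    using that f lip central by unfold_locales auto
  interpret X: deformed_template "f k" C\<^sub>L d \<eta> \<xi> \<xi>' \<tau> \<tau>' \<Xi>
    using reg[OF k] d \<eta> C adm \<Xi>_ge
    by (simp add: deformed_template_def deformed_template_axioms_def)
  have Xs_deformed: "deformed_template (f (ks m)) C\<^sub>L d (\<eta>s m) (\<xi>s m) (\<xi>s' m) (\<tau>s m) (\<tau>s' m) \<Xi>"
    if "m \<in> {1..n}" for m
    using that reg ks d \<eta>s C adms \<Xi>_ge
    by (simp add: deformed_template_def deformed_template_axioms_def)
  have Tsq: "square_integrable (?T (Xs m))" and Nsq: "square_integrable (?N (ks m))"
    and Tapp: "L2_norm_unit (\<lambda>p. ?T (Xs m) p - ?N (ks m) p) \<le> ?B" if m: "m \<in> {1..n}" for m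
  proof -
    interpret deformed_template "f (ks m)" C\<^sub>L d "\<eta>s m" "\<xi>s m" "\<xi>s' m" "\<tau>s m" "\<tau>s' m" \<Xi>
      by (rule Xs_deformed[OF m])
    show "square_integrable (?T (Xs m))" "square_integrable (?N (ks m))"
      "L2_norm_unit (\<lambda>p. ?T (Xs m) p - ?N (ks m) p) \<le> ?B"
      using square_integrable_transform square_integrable_normalized transform_approx Xs m by simp_all
  qed
  note X_facts = X.square_integrable_transform[folded X] X.square_integrable_normalized
    X.transform_approx[folded X]
  have i_range: "i \<in> {1..n}"
    using i unfolding is_alignment_index_def is_arg_min_linorder by blast
  have i_min: "L2_norm_unit (\<lambda>p. ?T X p - ?T (Xs i) p) \<le> L2_norm_unit (\<lambda>p. ?T X p - ?T (Xs m) p)"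
    if "m \<in> {1..n}" for m
    using i that unfolding is_alignment_index_def is_arg_min_linorder by blast+
  show "ks i = k"
  proof (rule ccontr)
    assume neq: "ks i \<noteq> k"
    \<comment> \<open>Both labels occur, so some training image shares the label of
      \<open>X\<close>; the minimizer is compared with it.\<close>
    obtain m where m: "m \<in> {1..n}" "ks m = k"
      using k both by auto
    have "L2_norm_unit (\<lambda>p. ?T X p - ?T (Xs i) p) \<le> L2_norm_unit (\<lambda>p. ?T X p - ?T (Xs m) p)"
      by (rule i_min[OF m(1)])
    also have "\<dots> \<le> L2_norm_unit (\<lambda>p. ?T X p - ?N k p) + L2_norm_unit (\<lambda>p. ?N k p - ?T (Xs m) p)"
      using X_facts Tsq[OF m(1)] by (intro L2_norm_unit_triangle_diff)
    also have "\<dots> \<le> ?B + ?B"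
      using X_facts(3) Tapp[OF m(1)] m(2)
      by (simp add: L2_norm_unit_minus_commute[of "?N k"])
    finally have near: "L2_norm_unit (\<lambda>p. ?T X p - ?T (Xs i) p) \<le> ?B + ?B" .
    \<comment> \<open>The path through \<open>?T X\<close> and \<open>?T (Xs i)\<close> costs
      \<open>?B\<close>, then \<open>?B + ?B\<close> by \<open>near\<close>, then
      \<open>?B\<close>.\<close>
    have "L2_norm_unit (\<lambda>p. ?N k p - ?N (ks i) p)
        \<le> L2_norm_unit (\<lambda>p. ?N k p - ?T X p) + L2_norm_unit (\<lambda>p. ?T X p - ?N (ks i) p)"
      using X_facts Nsq[OF i_range] by (intro L2_norm_unit_triangle_diff)
    also have "L2_norm_unit (\<lambda>p. ?T X p - ?N (ks i) p)
        \<le> L2_norm_unit (\<lambda>p. ?T X p - ?T (Xs i) p) + L2_norm_unit (\<lambda>p. ?T (Xs i) p - ?N (ks i) p)"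
      using X_facts Tsq[OF i_range] Nsq[OF i_range] by (intro L2_norm_unit_triangle_diff)
    finally have "L2_norm_unit (\<lambda>p. ?N k p - ?N (ks i) p) \<le> 4 * ?B"
      using near X_facts(3) Tapp[OF i_range]
      by (simp add: L2_norm_unit_minus_commute[of "?N k" "?T X"])
    \<comment> \<open>Two distinct labels are 0 and 1 in some order, and the norm of a difference is
      symmetric.\<close>
    moreover have "L2_norm_unit (\<lambda>p. ?N k p - ?N (ks i) p) = L2_norm_unit (\<lambda>p. ?N 0 p - ?N 1 p)"
    proof -
      have "ks i \<in> {0, 1}"
        using ks i_range by blast
      then consider "k = 0" "ks i = 1" | "k = 1" "ks i = 0"
        using k neq by force
      then show ?thesis
        by cases (simp_all only: L2_norm_unit_minus_commute[of "?N 1" "?N 0"])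
    qed
    moreover have "4 * ?B \<le> 4 * 8 * max C\<^sub>L (C\<^sub>L\<^sup>2) * \<Xi>\<^sup>2 / real d"
    proof -
      \<comment> \<open>The entry 1 in the maximum lets \<open>\<Xi>\<close> be replaced by its
        square.\<close>
      have "1 \<le> \<Xi>" by (rule \<Xi>_ge) simp
      then have "C\<^sub>L * \<Xi> \<le> max C\<^sub>L (C\<^sub>L\<^sup>2) * \<Xi>\<^sup>2"
        using C by (intro mult_mono) (auto simp: power2_eq_square)
      then show ?thesis
        by (simp add: divide_right_mono)
    qed
    ultimately have small: "L2_norm_unit (\<lambda>p. ?N 0 p - ?N 1 p) \<le> 4 * 8 * max C\<^sub>L (C\<^sub>L\<^sup>2) * \<Xi>\<^sup>2 / real d"
      by linarith
    have "max_separation (f 0) (f 1) \<le> ennreal (L2_norm_unit (\<lambda>p. ?N 0 p - ?N 1 p))"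
      by (rule max_separation_le_normalized[OF reg reg]) auto
    also have "\<dots> \<le> ennreal (4 * 8 * max C\<^sub>L (C\<^sub>L\<^sup>2) * \<Xi>\<^sup>2 / real d)"
      by (rule ennreal_leI[OF small])
    also have "\<dots> < max_separation (f 0) (f 1)"
      by (rule sep)
    finally show False by simp
  qed
qed simp

end
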